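(* Let $G=(V,E)$ be a finite, weighted, undirected, connected graph without self-loops, with $n\ge 2$ nodes and positive edge weights, and let $\pi$ be a probability distribution on $V$ with support $V$. Let $\sigma(A,B)=\frac{p(A,B)}{\pi(A)\pi(B)}$ for disjoint non-empty $A,B\subset V$. Then: (i) (Reducibility) for all pairwise disjoint non-empty sets $A,B,C\subset V$, $$\sigma(A\cup B,C)\le \max(\sigma(A,C),\sigma(B,C)).$$ (ii) For every run of the greedy agglomerative algorithm with linkage $\sigma$, the resulting dendrogram is regular: the sequence of distances $\sigma(A,B)^{-1}$ attached to the successive internal nodes created by the algorithm is non-decreasing. Moreover, the corresponding distance $d$ on $V$ is an ultrametric, i.e. $d$ is a metric on $V$ with $$d(u,v)\le\max(d(u,x),d(v,x))\quad\text{for all }u,v,x\in V.$$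
   Context: For $u,v\in V$, $w(u,v)=w(v,u)$ is the (positive) weight of the edge between $u$ and $v$ if there is one, and $w(u,v)=0$ otherwise (in particular $w(u,u)=0$). The total weight is $w=\sum_{u,v\in V}w(u,v)$ (sum over ordered pairs). For $A,B\subset V$, $w(A,B)=\sum_{u\in A,\,v\in B}w(u,v)$, $p(A,B)=w(A,B)/w$, and $\pi(A)=\sum_{u\in A}\pi(u)$. Greedy agglomerative algorithm with linkage $\sigma$: start from the partition of $V$ into $n$ singletons. At each step, choose two distinct clusters $A,B$ of the current partition maximizing $\sigma(A,B)$ (equivalently, minimizing the distance $\sigma(A,B)^{-1}$), with ties broken arbitrarily, and replace them by their union $A\cup B$; stop after $n-1$ merges, when the only cluster is $V$. This builds, from bottom to top, a rooted binary tree (dendrogram) whose leaves are the nodes of $G$ and whose internal nodes correspond to the merges: the merge of $A$ and $B$ creates an internal node, denoted $(A,B)$, whose two subtrees have leaf sets $A$ and $B$, and to which the distance (height) $\sigma(A,B)^{-1}$ is attached. The corresponding distance on $V$ is defined by $d(u,u)=0$ and, for $u\ne v$, $d(u,v)$ is the distance attached to the closest common ancestor of $u$ and $v$ in the dendrogram. *)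

theory Defs
  imports "HOL-Analysis.Abstract_Metric_Spaces" "HOL-Probability.Probability_Mass_Function"
begin

locale weighted_graph =
  fixes V :: "'a set" and E :: "'a set set" and w :: "'a \<Rightarrow> 'a \<Rightarrow> real"
  assumes finite_nodes: "finite V"
    and edges: "E \<subseteq> {{u, v} | u v. u \<in> V \<and> v \<in> V \<and> u \<noteq> v}"
    and weight_sym: "\<lbrakk>u \<in> V; v \<in> V\<rbrakk> \<Longrightarrow> w u v = w v u"
    and weight_pos: "\<lbrakk>u \<in> V; v \<in> V; {u, v} \<in> E\<rbrakk> \<Longrightarrow> w u v > 0"
    and weight_zero: "\<lbrakk>u \<in> V; v \<in> V; {u, v} \<notin> E\<rbrakk> \<Longrightarrow> w u v = 0"
    and connected: "\<lbrakk>u \<in> V; v \<in> V\<rbrakk> \<Longrightarrow> (u, v) \<in> {(x, y). {x, y} \<in> E}\<^sup>*"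

definition set_weight :: "('a \<Rightarrow> 'a \<Rightarrow> real) \<Rightarrow> 'a set \<Rightarrow> 'a set \<Rightarrow> real" where
  "set_weight w A B = (\<Sum>u\<in>A. \<Sum>v\<in>B. w u v)"

definition total_weight :: "'a set \<Rightarrow> ('a \<Rightarrow> 'a \<Rightarrow> real) \<Rightarrow> real" where
  "total_weight V w = (\<Sum>u\<in>V. \<Sum>v\<in>V. w u v)"

definition edge_prob :: "'a set \<Rightarrow> ('a \<Rightarrow> 'a \<Rightarrow> real) \<Rightarrow> 'a set \<Rightarrow> 'a set \<Rightarrow> real" where
  "edge_prob V w A B = set_weight w A B / total_weight V w"

definition node_prob :: "'a pmf \<Rightarrow> 'a set \<Rightarrow> real" where
  "node_prob \<pi> A = (\<Sum>u\<in>A. pmf \<pi> u)"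

definition linkage ::
    "'a set \<Rightarrow> ('a \<Rightarrow> 'a \<Rightarrow> real) \<Rightarrow> 'a pmf \<Rightarrow> 'a set \<Rightarrow> 'a set \<Rightarrow> real" where
  "linkage V w \<pi> A B = edge_prob V w A B / (node_prob \<pi> A * node_prob \<pi> B)"

datatype (leaves: 'a) dendrogram =
    Leaf 'a
  | Node "'a dendrogram" (height: real) "'a dendrogram"
  where "height (Leaf _) = 0"

text \<open>
  A state of the algorithm is the forest \<open>F\<close> of the dendrograms built so far; the current
  partition of \<open>V\<close> consists of their leaf sets. The list \<open>ns\<close> contains the internal nodes (as
  subtrees) in order of creation. The rules are nondeterministic, so that ties are broken
  arbitrarily. A run is complete when \<open>F\<close> is a singleton.

  Heights use the real \<open>inverse\<close>, with \<open>inverse 0 = 0\<close>. In a connected graph this convention is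
  harmless: some two clusters are always joined by an edge, so the maximal linkage is positive.
\<close>

inductive greedy_run ::
    "('a set \<Rightarrow> 'a set \<Rightarrow> real) \<Rightarrow> 'a set \<Rightarrow> 'a dendrogram set \<Rightarrow> 'a dendrogram list \<Rightarrow> bool"
  for \<sigma> :: "'a set \<Rightarrow> 'a set \<Rightarrow> real" and V :: "'a set" where
  singletons: "greedy_run \<sigma> V (Leaf ` V) []"
| merge: "\<lbrakk>greedy_run \<sigma> V F ns; S \<in> F; T \<in> F; S \<noteq> T;
      \<And>S' T'. \<lbrakk>S' \<in> F; T' \<in> F; S' \<noteq> T'\<rbrakk>
        \<Longrightarrow> \<sigma> (leaves S') (leaves T') \<le> \<sigma> (leaves S) (leaves T);
      N = Node S (inverse (\<sigma> (leaves S) (leaves T))) T\<rbrakk>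
    \<Longrightarrow> greedy_run \<sigma> V (insert N (F - {S, T})) (ns @ [N])"

primrec subtrees :: "'a dendrogram \<Rightarrow> 'a dendrogram set" where
  "subtrees (Leaf x) = {Leaf x}"
| "subtrees (Node S h T) = insert (Node S h T) (subtrees S \<union> subtrees T)"

definition common_ancestors :: "'a dendrogram \<Rightarrow> 'a \<Rightarrow> 'a \<Rightarrow> 'a dendrogram set" where
  "common_ancestors D u v = {S \<in> subtrees D. u \<in> leaves S \<and> v \<in> leaves S}"

definition closest_common_ancestor :: "'a dendrogram \<Rightarrow> 'a \<Rightarrow> 'a \<Rightarrow> 'a dendrogram" where
  "closest_common_ancestor D u v =
    (THE S. S \<in> common_ancestors D u v \<and> (\<forall>T \<in> common_ancestors D u v. S \<in> subtrees T))"

text \<open>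
  The value \<open>0\<close> outside the leaves is immaterial, but \<open>Metric_space\<close> asks for nonnegativity
  and symmetry on the whole type.
\<close>

definition dendrogram_dist :: "'a dendrogram \<Rightarrow> 'a \<Rightarrow> 'a \<Rightarrow> real" where
  "dendrogram_dist D u v =
    (if u \<in> leaves D \<and> v \<in> leaves D \<and> u \<noteq> v
     then height (closest_common_ancestor D u v) else 0)"

definition ultrametric_on :: "'a set \<Rightarrow> ('a \<Rightarrow> 'a \<Rightarrow> real) \<Rightarrow> bool" where
  "ultrametric_on V d \<longleftrightarrow>
    Metric_space V d \<and> (\<forall>u\<in>V. \<forall>v\<in>V. \<forall>x\<in>V. d u v \<le> max (d u x) (d v x))"

end

(*
  Since p is additive, sigma (A Un B, C) is the average of sigma (A, C) and sigma (B, C) with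
  weights pi A and pi B; this gives reducibility. Consequently, a merge never creates a pair of
  clusters with a linkage above the maximum just attained, so the maximal linkage decreases along
  a run and the heights increase. Connectivity keeps the maximal linkage positive, so that
  inverting it is harmless. In a tree whose heights are positive and increase towards the root,
  the height of the closest common ancestor is an ultrametric.
*)

theory Submission
  imports Defs
begin

section \<open>Subtrees and closest common ancestors\<close>

lemma leaves_nonempty [simp]: "leaves D \<noteq> {}"
  by (induction D) auto

lemma subtrees_refl [simp]: "D \<in> subtrees D"
  by (cases D) auto

lemma leaves_subtree: "S \<in> subtrees D \<Longrightarrow> leaves S \<subseteq> leaves D"
  by (induction D) auto

lemma size_subtree: "S \<in> subtrees D \<Longrightarrow> S = D \<or> size S < size D"
  by (induction D) auto

lemma subtrees_antisym: "S \<in> subtrees T \<Longrightarrow> T \<in> subtrees S \<Longrightarrow> S = T"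
  using size_subtree[of S T] size_subtree[of T S] by auto

text \<open>Antisymmetry of the subtree order supplies the uniqueness that \<open>THE\<close> needs,
  so exhibiting a least common ancestor suffices.\<close>

lemma closest_common_ancestor_eqI:
  assumes "S \<in> common_ancestors D u v" and "\<And>T. T \<in> common_ancestors D u v \<Longrightarrow> S \<in> subtrees T"
  shows "closest_common_ancestor D u v = S"
  unfolding closest_common_ancestor_def
  using assms by (intro the_equality) (auto intro: subtrees_antisym)

text \<open>Regularity of a single tree compares each node with its children only, in contrast to
  the order of creation in the theorem. Disjoint leaf sets give every pair of leaves a least common
  ancestor, and \<open>h > 0\<close> will separate points.\<close>

primrec regular :: "'a dendrogram \<Rightarrow> bool" where
  "regular (Leaf x) = True"
| "regular (Node S h T) =
    (regular S \<and> regular T \<and> leaves S \<inter> leaves T = {} \<and>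
     h > 0 \<and> height S \<le> h \<and> height T \<le> h)"

lemma regular_height_nonneg: "regular D \<Longrightarrow> height D \<ge> 0"
  by (cases D) auto

text \<open>The leaves of a subtree stay on its own side, so a side that misses \<open>u\<close> or
  \<open>v\<close> contributes no common ancestor. The root always does.\<close>

lemma common_ancestors_Node:
  assumes "leaves S \<inter> leaves T = {}"
  shows "u \<in> leaves S \<Longrightarrow> v \<in> leaves S \<Longrightarrow>
      common_ancestors (Node S h T) u v = insert (Node S h T) (common_ancestors S u v)"
    and "u \<in> leaves T \<Longrightarrow> v \<in> leaves T \<Longrightarrow>
      common_ancestors (Node S h T) u v = insert (Node S h T) (common_ancestors T u v)"
    and "u \<in> leaves S \<Longrightarrow> v \<in> leaves T \<Longrightarrow> common_ancestors (Node S h T) u v = {Node S h T}"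
    and "u \<in> leaves T \<Longrightarrow> v \<in> leaves S \<Longrightarrow> common_ancestors (Node S h T) u v = {Node S h T}"
  using assms leaves_subtree[of _ S] leaves_subtree[of _ T]
  unfolding common_ancestors_def by fastforce+

text \<open>If the root separates the two leaves, it is their only common ancestor. Otherwise the
  least one comes from the side holding both.\<close>

lemma closest_common_ancestor_exists:
  assumes "regular D" "u \<in> leaves D" "v \<in> leaves D"
  shows "\<exists>S \<in> common_ancestors D u v. \<forall>T \<in> common_ancestors D u v. S \<in> subtrees T"
  using assms
proof (induction D)
  case (Leaf x)
  then show ?case by (auto simp: common_ancestors_def)
next
  case (Node S h T)
  have dis: "leaves S \<inter> leaves T = {}" using Node.prems by simp
  consider "u \<in> leaves S" "v \<in> leaves S" | "u \<in> leaves T" "v \<in> leaves T"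
    | "u \<in> leaves S" "v \<in> leaves T" | "u \<in> leaves T" "v \<in> leaves S"
    using Node.prems by auto
  then show ?case
  proof cases
    case 1
    then obtain c where "c \<in> common_ancestors S u v"
        "\<forall>T \<in> common_ancestors S u v. c \<in> subtrees T"
      using Node by auto
    moreover from this have "c \<in> subtrees (Node S h T)"
      by (simp add: common_ancestors_def)
    ultimately show ?thesis
      using 1 by (simp add: common_ancestors_Node[OF dis]) blast
  next
    case 2
    then obtain c where "c \<in> common_ancestors T u v"
        "\<forall>S \<in> common_ancestors T u v. c \<in> subtrees S"
      using Node by auto
    moreover from this have "c \<in> subtrees (Node S h T)"
      by (simp add: common_ancestors_def)
    ultimately show ?thesis
      using 2 by (simp add: common_ancestors_Node[OF dis]) blast
  qed (simp_all add: common_ancestors_Node[OF dis])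
qed

lemma closest_common_ancestor_Node:
  assumes "regular (Node S h T)"
  shows "u \<in> leaves S \<Longrightarrow> v \<in> leaves S \<Longrightarrow>
      closest_common_ancestor (Node S h T) u v = closest_common_ancestor S u v"
    and "u \<in> leaves T \<Longrightarrow> v \<in> leaves T \<Longrightarrow>
      closest_common_ancestor (Node S h T) u v = closest_common_ancestor T u v"
    and "u \<in> leaves S \<Longrightarrow> v \<in> leaves T \<Longrightarrow> closest_common_ancestor (Node S h T) u v = Node S h T"
    and "u \<in> leaves T \<Longrightarrow> v \<in> leaves S \<Longrightarrow> closest_common_ancestor (Node S h T) u v = Node S h T"
proof -
  have dis: "leaves S \<inter> leaves T = {}" and reg: "regular S" "regular T"
    using assms by auto
  show "closest_common_ancestor (Node S h T) u v = closest_common_ancestor S u v"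
    if uv: "u \<in> leaves S" "v \<in> leaves S"
  proof -
    obtain c where c: "c \<in> common_ancestors S u v" "\<forall>T \<in> common_ancestors S u v. c \<in> subtrees T"
      using closest_common_ancestor_exists[OF reg(1) uv] by blast
    \<comment> \<open>Passing from \<open>S\<close> to the whole tree adds one common ancestor, the
      root; \<open>c\<close> lies below it too and so stays least.\<close>
    have "c \<in> subtrees (Node S h T)"
      using c(1) by (simp add: common_ancestors_def)
    then have "closest_common_ancestor (Node S h T) u v = c"
      using c by (intro closest_common_ancestor_eqI) (auto simp: common_ancestors_Node[OF dis] uv)
    moreover have "closest_common_ancestor S u v = c"
      using c by (intro closest_common_ancestor_eqI) auto
    ultimately show ?thesis by simp
  qed
  show "closest_common_ancestor (Node S h T) u v = closest_common_ancestor T u v"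
    if uv: "u \<in> leaves T" "v \<in> leaves T"
  proof -
    obtain c where c: "c \<in> common_ancestors T u v" "\<forall>S \<in> common_ancestors T u v. c \<in> subtrees S"
      using closest_common_ancestor_exists[OF reg(2) uv] by blast
    have "c \<in> subtrees (Node S h T)"
      using c(1) by (simp add: common_ancestors_def)
    then have "closest_common_ancestor (Node S h T) u v = c"
      using c by (intro closest_common_ancestor_eqI) (auto simp: common_ancestors_Node[OF dis] uv)
    moreover have "closest_common_ancestor T u v = c"
      using c by (intro closest_common_ancestor_eqI) auto
    ultimately show ?thesis by simp
  qed
  show "u \<in> leaves S \<Longrightarrow> v \<in> leaves T \<Longrightarrow> closest_common_ancestor (Node S h T) u v = Node S h T"
    and "u \<in> leaves T \<Longrightarrow> v \<in> leaves S \<Longrightarrow> closest_common_ancestor (Node S h T) u v = Node S h T"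
    by (rule closest_common_ancestor_eqI; simp add: common_ancestors_Node[OF dis])+
qed

section \<open>The ultrametric of a regular tree\<close>

text \<open>These recursion equations replace the definite description in the inductions on trees
  that follow.\<close>

lemma dendrogram_dist_Node:
  assumes "regular (Node S h T)"
  shows "u \<in> leaves S \<Longrightarrow> v \<in> leaves S \<Longrightarrow>
      dendrogram_dist (Node S h T) u v = dendrogram_dist S u v"
    and "u \<in> leaves T \<Longrightarrow> v \<in> leaves T \<Longrightarrow>
      dendrogram_dist (Node S h T) u v = dendrogram_dist T u v"
    and "u \<in> leaves S \<Longrightarrow> v \<in> leaves T \<Longrightarrow> dendrogram_dist (Node S h T) u v = h"
    and "u \<in> leaves T \<Longrightarrow> v \<in> leaves S \<Longrightarrow> dendrogram_dist (Node S h T) u v = h"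
  using assms by (auto simp: dendrogram_dist_def closest_common_ancestor_Node[OF assms])

lemma dendrogram_dist_self [simp]: "dendrogram_dist D u u = 0"
  by (simp add: dendrogram_dist_def)

lemma dendrogram_dist_commute: "dendrogram_dist D u v = dendrogram_dist D v u"
proof -
  have "common_ancestors D u v = common_ancestors D v u"
    by (auto simp: common_ancestors_def)
  then have "closest_common_ancestor D u v = closest_common_ancestor D v u"
    by (simp add: closest_common_ancestor_def)
  then show ?thesis
    by (auto simp: dendrogram_dist_def)
qed

lemma dendrogram_dist_le_height:
  assumes "regular D" "u \<in> leaves D" "v \<in> leaves D"
  shows "dendrogram_dist D u v \<le> height D"
  using assms
proof (induction D)
  case (Node S h T)
  have "height S \<le> h" "height T \<le> h" using Node.prems by auto
  then show ?case
    using Node by (auto simp: dendrogram_dist_Node[OF Node.prems(1)] intro: order_trans)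
qed simp

lemma dendrogram_dist_pos:
  assumes "regular D" "u \<in> leaves D" "v \<in> leaves D" "u \<noteq> v"
  shows "dendrogram_dist D u v > 0"
  using assms
proof (induction D)
  case (Node S h T)
  then show ?case by (auto simp: dendrogram_dist_Node[OF Node.prems(1)])
qed simp

text \<open>No distance exceeds the root height \<open>h\<close>. If the root separates
  \<open>x\<close> from \<open>u\<close> or from \<open>v\<close>, the right-hand side is therefore
  large enough; otherwise all three leaves lie on one side and induction applies.\<close>

lemma dendrogram_dist_ultra:
  assumes "regular D" "u \<in> leaves D" "v \<in> leaves D" "x \<in> leaves D"
  shows "dendrogram_dist D u v \<le> max (dendrogram_dist D u x) (dendrogram_dist D v x)"
  using assms
proof (induction D)
  case (Node S h T)
  note dist = dendrogram_dist_Node[OF Node.prems(1)]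
  have le: "dendrogram_dist (Node S h T) u v \<le> h"
    using dendrogram_dist_le_height[OF Node.prems(1-3)] by simp
  consider "u \<in> leaves S" "v \<in> leaves S" "x \<in> leaves S"
    | "u \<in> leaves T" "v \<in> leaves T" "x \<in> leaves T"
    | "dendrogram_dist (Node S h T) u x = h \<or> dendrogram_dist (Node S h T) v x = h"
  proof -
    have "u \<in> leaves S \<or> u \<in> leaves T" "v \<in> leaves S \<or> v \<in> leaves T"
        "x \<in> leaves S \<or> x \<in> leaves T"
      using Node.prems by auto
    then show thesis
      using that dist(3,4)[of u x] dist(3,4)[of v x] by blast
  qed
  then show ?case
  proof cases
    case 1
    then show ?thesis using Node.IH(1) Node.prems(1) dist(1) by simp
  next
    case 2
    then show ?thesis using Node.IH(2) Node.prems(1) dist(2) by simp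
  next
    case 3
    then show ?thesis using le by linarith
  qed
qed simp

lemma regular_imp_ultrametric:
  assumes "regular D"
  shows "ultrametric_on (leaves D) (dendrogram_dist D)"
  unfolding ultrametric_on_def
proof
  have nonneg: "0 \<le> dendrogram_dist D u v" for u v
    using dendrogram_dist_pos[OF assms, of u v] by (cases "u \<in> leaves D \<and> v \<in> leaves D \<and> u \<noteq> v")
      (auto simp: dendrogram_dist_def)
  show "Metric_space (leaves D) (dendrogram_dist D)"
  proof
    fix u v x assume *: "u \<in> leaves D" "v \<in> leaves D" "x \<in> leaves D"
    \<comment> \<open>The triangle inequality follows because a maximum of nonnegative numbers is at
      most their sum.\<close>
    have "dendrogram_dist D u x \<le> max (dendrogram_dist D u v) (dendrogram_dist D x v)"
      using * by (intro dendrogram_dist_ultra assms)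
    then show "dendrogram_dist D u x \<le> dendrogram_dist D u v + dendrogram_dist D v x"
      using nonneg[of u v] nonneg[of v x] dendrogram_dist_commute[of D x v] by linarith
  next
    fix u v assume "u \<in> leaves D" "v \<in> leaves D"
    then show "dendrogram_dist D u v = 0 \<longleftrightarrow> u = v"
      using dendrogram_dist_pos[OF assms, of u v] by force
  qed (auto simp: nonneg dendrogram_dist_commute)
  show "\<forall>u\<in>leaves D. \<forall>v\<in>leaves D. \<forall>x\<in>leaves D.
      dendrogram_dist D u v \<le> max (dendrogram_dist D u x) (dendrogram_dist D v x)"
    by (intro ballI dendrogram_dist_ultra assms)
qed

section \<open>Greedy runs for an abstract reducible linkage\<close>

text \<open>This isolates what the analysis of runs needs from the graph. Connectivity survives as
  \<open>linked\<close>: whatever family covers the complement of \<open>A\<close>, some member has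
  positive linkage with \<open>A\<close>.\<close>

locale reducible_linkage =
  fixes V :: "'a set" and \<sigma> :: "'a set \<Rightarrow> 'a set \<Rightarrow> real"
  assumes linkage_sym: "\<lbrakk>A \<subseteq> V; B \<subseteq> V\<rbrakk> \<Longrightarrow> \<sigma> A B = \<sigma> B A"
    and reducible: "\<lbrakk>A \<subseteq> V; B \<subseteq> V; C \<subseteq> V; A \<noteq> {}; B \<noteq> {}; C \<noteq> {};
      A \<inter> B = {}; A \<inter> C = {}; B \<inter> C = {}\<rbrakk> \<Longrightarrow> \<sigma> (A \<union> B) C \<le> max (\<sigma> A C) (\<sigma> B C)"
    and linked: "\<lbrakk>A \<subset> V; A \<noteq> {}; \<Union>P = V - A\<rbrakk> \<Longrightarrow> \<exists>B\<in>P. \<sigma> A B > 0"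
begin

text \<open>Indexing the disjoint family by trees, rather than by leaf sets, also rules out two
  trees with the same leaves.\<close>

lemma greedy_run_partition:
  assumes "greedy_run \<sigma> V F ns"
  shows "\<Union>(leaves ` F) = V \<and> disjoint_family_on leaves F"
  using assms
proof induction
  case singletons
  then show ?case by (auto simp: disjoint_family_on_def)
next
  case (merge F ns S T N)
  then have leaves_N: "leaves N = leaves S \<union> leaves T"
    by simp
  have "\<Union>(leaves ` insert N (F - {S, T})) = \<Union>(leaves ` F)"
    using leaves_N merge.hyps(2,3) by blast
  moreover have "disjoint_family_on leaves (F - {S, T})"
    using merge.IH by (auto simp: disjoint_family_on_def)
  moreover have "leaves N \<inter> leaves R = {}" if "R \<in> F - {S, T}" for R
    using that merge.IH merge.hyps(2,3) unfolding leaves_N disjoint_family_on_def by blast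
  \<comment> \<open>Otherwise the nonempty set \<open>leaves N\<close> would be disjoint from
    itself.\<close>
  moreover have "N \<notin> F - {S, T}"
    using calculation(3) leaves_nonempty[of N] by blast
  ultimately show ?case
    using merge.IH by (auto simp: disjoint_family_on_insert)
qed

text \<open>The invariant carries two auxiliary facts. Current linkages are bounded by the inverse
  of every recorded height, which makes the next height at least as large. Each tree has height 0 or
  is recorded, so the new height also dominates those of the two merged trees.\<close>

lemma greedy_run_regular:
  assumes "greedy_run \<sigma> V F ns"
  shows "sorted (map height ns) \<and> (\<forall>D\<in>F. regular D \<and> (height D = 0 \<or> D \<in> set ns)) \<and>
    (\<forall>N\<in>set ns. height N > 0 \<and>
      (\<forall>S\<in>F. \<forall>T\<in>F. S \<noteq> T \<longrightarrow> \<sigma> (leaves S) (leaves T) \<le> inverse (height N)))"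
  using assms
proof induction
  case singletons
  then show ?case by auto
next
  case (merge F ns S T N)
  have IH_sorted: "sorted (map height ns)"
    and IH_tree: "\<And>D. D \<in> F \<Longrightarrow> regular D" "\<And>D. D \<in> F \<Longrightarrow> height D = 0 \<or> D \<in> set ns"
    and IH_pos: "\<And>K. K \<in> set ns \<Longrightarrow> height K > 0"
    and IH_bound: "\<And>K. K \<in> set ns \<Longrightarrow> \<sigma> (leaves S) (leaves T) \<le> inverse (height K)"
    using merge.IH merge.hyps(2-4) by blast+
  define m where "m = \<sigma> (leaves S) (leaves T)"
  have max: "\<sigma> (leaves S') (leaves T') \<le> m" if "S' \<in> F" "T' \<in> F" "S' \<noteq> T'" for S' T'
    using merge.hyps(5) that by (simp add: m_def)
  have cover: "\<Union>(leaves ` F) = V" and dis: "disjoint_family_on leaves F"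
    using greedy_run_partition[OF merge.hyps(1)] by auto
  have sub: "leaves S' \<subseteq> V" if "S' \<in> F" for S'
    using cover that by blast
  have disj: "leaves S' \<inter> leaves T' = {}" if "S' \<in> F" "T' \<in> F" "S' \<noteq> T'" for S' T'
    using dis that by (auto simp: disjoint_family_on_def)
  have "leaves S \<subset> V"
    using sub[of S] sub[of T] disj[of S T] merge.hyps(2-4) leaves_nonempty[of T] by blast
  moreover have "\<Union>(leaves ` (F - {S})) = V - leaves S"
    using cover disj[of S] merge.hyps(2) by blast
  \<comment> \<open>Some other cluster has positive linkage with \<open>leaves S\<close>; as the
    chosen pair is maximal, \<open>m\<close> is positive as well.\<close>
  ultimately obtain T' where "T' \<in> F" "T' \<noteq> S" "\<sigma> (leaves S) (leaves T') > 0"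
    using linked[of "leaves S" "leaves ` (F - {S})"] by auto
  then have m: "m > 0"
    using max[of S T'] merge.hyps(2) by fastforce
  have N: "N = Node S (inverse m) T"
    using merge.hyps(6) by (simp add: m_def)
  have le: "height K \<le> inverse m" if "K \<in> set ns" for K
  proof -
    have "m \<le> inverse (height K)"
      using IH_bound that by (simp add: m_def)
    then show ?thesis
      using m le_imp_inverse_le[of m "inverse (height K)"] by simp
  qed
  have le_inv: "\<sigma> (leaves S') (leaves T') \<le> m"
    if ST: "S' \<in> insert N (F - {S, T})" "T' \<in> insert N (F - {S, T})" "S' \<noteq> T'" for S' T'
  proof -
    \<comment> \<open>Reducibility enters here: a pair with the new cluster is bounded by two pairs
      that competed in the previous step, hence by \<open>m\<close>.\<close>
    have new: "\<sigma> (leaves N) (leaves R) \<le> m" if R: "R \<in> F - {S, T}" for R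
    proof -
      have "\<sigma> (leaves S \<union> leaves T) (leaves R)
          \<le> max (\<sigma> (leaves S) (leaves R)) (\<sigma> (leaves T) (leaves R))"
        using R merge.hyps(2-4) by (intro reducible sub disj leaves_nonempty) auto
      also have "\<dots> \<le> m"
        using R max merge.hyps(2-4) by auto
      finally show ?thesis by (simp add: N)
    qed
    have "leaves N \<subseteq> V" using sub merge.hyps(2,3) by (auto simp: N)
    then have "\<sigma> (leaves R) (leaves N) = \<sigma> (leaves N) (leaves R)" if "R \<in> F" for R
      using linkage_sym sub that by blast
    with new max ST show ?thesis by auto
  qed
  \<comment> \<open>For old nodes this is the induction hypothesis; for \<open>N\<close> it is an
    equality.\<close>
  have "m \<le> inverse (height K)" if "K \<in> set (ns @ [N])" for K
    using that IH_bound by (auto simp: m_def N)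
  then have bound: "\<sigma> (leaves S') (leaves T') \<le> inverse (height K)"
    if "S' \<in> insert N (F - {S, T})" "T' \<in> insert N (F - {S, T})" "S' \<noteq> T'" "K \<in> set (ns @ [N])"
    for S' T' K
    using le_inv[OF that(1-3)] that(4) by fastforce
  \<comment> \<open>A tree of height 0 is covered by \<open>m > 0\<close>, a recorded one by
    \<open>le\<close>.\<close>
  have "height R \<le> inverse m" if "R \<in> F" for R
    using IH_tree(2)[OF that] m le[of R] by auto
  then have "regular N"
    using IH_tree(1) merge.hyps(2-4) m disj[of S T] by (simp add: N)
  show ?case
  proof (intro conjI ballI impI)
    show "sorted (map height (ns @ [N]))"
      using IH_sorted le by (auto simp: sorted_append N)
    show "regular D" "height D = 0 \<or> D \<in> set (ns @ [N])" if "D \<in> insert N (F - {S, T})" for D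
      using IH_tree[of D] that \<open>regular N\<close> by auto
    show "height K > 0" if "K \<in> set (ns @ [N])" for K
      using IH_pos[of K] m that by (auto simp: N)
  qed (rule bound)
qed

lemma greedy_run_ultrametric:
  assumes "greedy_run \<sigma> V {D} ns"
  shows "ultrametric_on V (dendrogram_dist D)"
proof -
  have "regular D"
    using greedy_run_regular[OF assms] by blast
  moreover have "leaves D = V"
    using greedy_run_partition[OF assms] by simp
  ultimately show ?thesis
    using regular_imp_ultrametric by blast
qed

end

section \<open>The linkage of a weighted graph\<close>

lemma node_prob_pos:
  assumes "A \<subseteq> set_pmf \<pi>" "finite A" "A \<noteq> {}"
  shows "node_prob \<pi> A > 0"
  unfolding node_prob_def using assms by (intro sum_pos) (auto simp: pmf_positive)

context weighted_graph
begin

lemma weight_nonneg: "u \<in> V \<Longrightarrow> v \<in> V \<Longrightarrow> w u v \<ge> 0"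
  using weight_pos[of u v] weight_zero[of u v] by fastforce

lemma finite_subset_nodes: "A \<subseteq> V \<Longrightarrow> finite A"
  using finite_nodes finite_subset by blast

lemma set_weight_commute: "A \<subseteq> V \<Longrightarrow> B \<subseteq> V \<Longrightarrow> set_weight w A B = set_weight w B A"
  unfolding set_weight_def
  by (subst sum.swap) (auto intro!: sum.cong weight_sym)

lemma set_weight_Un:
  "A \<subseteq> V \<Longrightarrow> B \<subseteq> V \<Longrightarrow> A \<inter> B = {} \<Longrightarrow>
    set_weight w (A \<union> B) C = set_weight w A C + set_weight w B C"
  unfolding set_weight_def by (intro sum.union_disjoint finite_subset_nodes)

text \<open>Nonnegative weights let a single edge bound a whole sum from below; this yields
  positivity of cut weights and of the total weight.\<close>

lemma set_weight_ge:
  assumes "A \<subseteq> V" "B \<subseteq> V" "x \<in> A" "y \<in> B"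
  shows "w x y \<le> set_weight w A B"
proof -
  have "w x y \<le> (\<Sum>v\<in>B. w x v)"
    using assms weight_nonneg by (intro member_le_sum finite_subset_nodes) auto
  also have "\<dots> \<le> set_weight w A B"
    unfolding set_weight_def
    using assms weight_nonneg
    by (intro member_le_sum[of x A "\<lambda>u. \<Sum>v\<in>B. w u v"] finite_subset_nodes sum_nonneg) auto
  finally show ?thesis .
qed

text \<open>A path from inside \<open>A\<close> to outside must leave \<open>A\<close> along some
  edge.\<close>

lemma cut_edge:
  assumes "A \<subset> V" "A \<noteq> {}"
  obtains x y where "x \<in> A" "y \<in> V - A" "w x y > 0"
proof -
  obtain u v where u: "u \<in> A" and v: "v \<in> V - A" using assms by blast
  then have "(u, v) \<in> {(x, y). {x, y} \<in> E}\<^sup>*"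
    using assms connected by blast
  \<comment> \<open>The implication lets the induction along the path pass through vertices still in
    \<open>A\<close>; the first vertex outside yields the edge.\<close>
  then have "v \<notin> A \<longrightarrow> (\<exists>x y. x \<in> A \<and> y \<notin> A \<and> {x, y} \<in> E)"
    by induction (use u in auto)
  then obtain x y where "x \<in> A" "y \<notin> A" "{x, y} \<in> E" using v by blast
  moreover from this have "x \<in> V" "y \<in> V"
    using edges by (fastforce simp: doubleton_eq_iff)+
  ultimately show thesis using that weight_pos by blast
qed

lemma linkage_reducible:
  assumes "set_pmf \<pi> = V"
    and sub: "A \<subseteq> V" "B \<subseteq> V" "C \<subseteq> V" and ne: "A \<noteq> {}" "B \<noteq> {}" "C \<noteq> {}"
    and disj: "A \<inter> B = {}"
  shows "linkage V w \<pi> (A \<union> B) C \<le> max (linkage V w \<pi> A C) (linkage V w \<pi> B C)"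
    (is "_ \<le> ?M")
proof -
  define a b c where "a = node_prob \<pi> A" and "b = node_prob \<pi> B" and "c = node_prob \<pi> C"
  have pos: "a > 0" "b > 0" "c > 0"
    using assms by (simp_all add: a_def b_def c_def node_prob_pos finite_subset_nodes)
  have p: "edge_prob V w A C = linkage V w \<pi> A C * (a * c)"
      "edge_prob V w B C = linkage V w \<pi> B C * (b * c)"
    using pos by (simp_all add: linkage_def a_def b_def c_def)
  have "edge_prob V w (A \<union> B) C = edge_prob V w A C + edge_prob V w B C"
    using sub disj by (simp add: edge_prob_def set_weight_Un add_divide_distrib)
  \<comment> \<open>Both linkages are replaced by their maximum; the remaining factor
    \<open>(a + b) * c\<close> is the denominator of the linkage of the union.\<close>
  also have "\<dots> \<le> ?M * (a * c) + ?M * (b * c)"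
    unfolding p using pos by (intro add_mono mult_right_mono) auto
  also have "\<dots> = ?M * ((a + b) * c)"
    by (simp add: algebra_simps)
  finally have "edge_prob V w (A \<union> B) C / ((a + b) * c) \<le> ?M"
    using pos by (subst pos_divide_le_eq) auto
  moreover have "node_prob \<pi> (A \<union> B) = a + b"
    unfolding node_prob_def a_def b_def
    using sub disj by (intro sum.union_disjoint finite_subset_nodes)
  ultimately show ?thesis
    by (simp add: linkage_def c_def)
qed

lemma linkage_reducible_linkage:
  assumes \<pi>: "set_pmf \<pi> = V"
  shows "reducible_linkage V (linkage V w \<pi>)"
proof
  fix A B assume "A \<subseteq> V" "B \<subseteq> V"
  then show "linkage V w \<pi> A B = linkage V w \<pi> B A"
    by (simp add: linkage_def edge_prob_def set_weight_commute[of A B] mult.commute)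
next
  fix A and P :: "'a set set" assume A: "A \<subset> V" "A \<noteq> {}" and P: "\<Union>P = V - A"
  obtain x y where xy: "x \<in> A" "y \<in> V - A" "w x y > 0"
    using cut_edge[OF A] .
  \<comment> \<open>The witness is the member of \<open>P\<close> that the cut edge from
    \<open>A\<close> enters.\<close>
  then obtain B where B: "B \<in> P" "y \<in> B" using P by blast
  then have "B \<subseteq> V" using P by blast
  have "set_weight w A B > 0"
    using set_weight_ge[of A B x y] A \<open>B \<subseteq> V\<close> xy B by auto
  \<comment> \<open>The same edge counts in the total weight, which is the set weight of
    \<open>V\<close> with itself.\<close>
  moreover have "total_weight V w > 0"
    using set_weight_ge[of V V x y] A xy by (auto simp: total_weight_def set_weight_def)
  moreover have "node_prob \<pi> A > 0" "node_prob \<pi> B > 0"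
    using node_prob_pos[of _ \<pi>] finite_subset_nodes A B \<open>B \<subseteq> V\<close> \<pi> by auto
  ultimately have "linkage V w \<pi> A B > 0"
    by (simp add: linkage_def edge_prob_def)
  then show "\<exists>B\<in>P. linkage V w \<pi> A B > 0"
    using B by blast
qed (use linkage_reducible[OF \<pi>] in blast)

end

theorem mainTheorem2:
  fixes V :: "'a set" and E :: "'a set set" and w :: "'a \<Rightarrow> 'a \<Rightarrow> real" and \<pi> :: "'a pmf"
  assumes "weighted_graph V E w"
    and "card V \<ge> 2"
    and "set_pmf \<pi> = V"
  shows "(\<forall>A B C. A \<subseteq> V \<and> B \<subseteq> V \<and> C \<subseteq> V \<and> A \<noteq> {} \<and> B \<noteq> {} \<and> C \<noteq> {} \<and>
            A \<inter> B = {} \<and> A \<inter> C = {} \<and> B \<inter> C = {} \<longrightarrow>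
            linkage V w \<pi> (A \<union> B) C \<le> max (linkage V w \<pi> A C) (linkage V w \<pi> B C)) \<and>
         (\<forall>D ns. greedy_run (linkage V w \<pi>) V {D} ns \<longrightarrow>
            sorted (map height ns) \<and> ultrametric_on V (dendrogram_dist D))"
proof -
  interpret weighted_graph V E w using assms(1) .
  \<comment> \<open>Claim (i) is now the reducibility assumption of the abstract setting, and claim
    (ii) its two results on runs.\<close>
  interpret reducible_linkage V "linkage V w \<pi>"
    using linkage_reducible_linkage assms(3) .
  show ?thesis
  proof (intro conjI allI impI)
    fix A B C
    assume "A \<subseteq> V \<and> B \<subseteq> V \<and> C \<subseteq> V \<and> A \<noteq> {} \<and> B \<noteq> {} \<and> C \<noteq> {} \<and>
      A \<inter> B = {} \<and> A \<inter> C = {} \<and> B \<inter> C = {}"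
    then show "linkage V w \<pi> (A \<union> B) C \<le> max (linkage V w \<pi> A C) (linkage V w \<pi> B C)"
      by (intro reducible) simp_all
  next
    fix D ns
    assume run: "greedy_run (linkage V w \<pi>) V {D} ns"
    show "sorted (map height ns)"
      using greedy_run_regular[OF run] by (rule conjunct1)
    show "ultrametric_on V (dendrogram_dist D)"
      using run by (rule greedy_run_ultrametric)
  qed
qed

end
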